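(* Let $A=(a_1,\dots,a_m)'$ and $Q=(q_1,\dots,q_m)'$ be two numerical vectors with $\min(a_1,\dots,a_m)\ge0$, $\max(a_1,\dots,a_m)>0$ and $0=q_0<q_1<q_2<\dots<q_m=1$. Let $X$ be a continuous random variable and $X_{A,Q}$ the step-weighted version of $X$ associated with $A$ and $Q$. Then: \begin{itemize} \item $F_{X_{A,Q}}(x)=G_{A,Q}(F_X(x))$ for any $x\in\mathbb R$; \item $F_{X_{A,Q}}^{-1}(p)=F_X^{-1}(G_{A,Q}^{-1}(p))$ for any $p\in(0,1)$; \item $F_{X_{A,Q}}^{-1+}(p)=F_X^{-1+}(G_{A,Q}^{-1+}(p))$ for any $p\in(0,1)$. \end{itemize}
   Context: A random variable $X$ is called continuous if its distribution function $F_X(x)=P(X\le x)$ is continuous on $\mathbb R$. For a distribution function $F$ and $p\in[0,1]$: $F^{-1}(p)=\inf\{x\in\mathbb R: F(x)\ge p\}$ and $F^{-1+}(p)=\sup\{x\in\mathbb R: F(x)\le p\}$, with $\inf\emptyset=+\infty$, $\sup\emptyset=-\infty$, $\inf\mathbb R=-\infty$, $\sup\mathbb R=+\infty$. Step-weighting: for a continuous random variable $X$ and vectors $A,Q$ as in the claim, the step-weight function $\omega_{A,Q}=\omega_{A,Q,X}:\mathbb R\to[0,\infty)$ is: $a_1$ for $F_X^{-1+}(q_0)\le x<F_X^{-1}(q_1)$; $a_k$ for $F_X^{-1}(q_{k-1})\le x<F_X^{-1}(q_k)$, $k=2,\dots,m-1$; $a_m$ for $F_X^{-1}(q_{m-1})\le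 x\le F_X^{-1}(q_m)$; and $0$ otherwise (for $m=1$ it is $a_1$ on $F_X^{-1+}(0)\le x\le F_X^{-1}(1)$, and $0$ otherwise). The step-weighted version $X_{A,Q}$ is a random variable with distribution function determined by $dF_{X_{A,Q}}(x)=\frac{\omega_{A,Q}(x)}{E[\omega_{A,Q}(X)]}\,dF_X(x)$. With $a=\sum_{i=1}^m a_i(q_i-q_{i-1})$, the function $G_{A,Q}:[0,1]\to[0,1]$ is the continuous nondecreasing function $$G_{A,Q}(t)=a^{-1}\Big(\sum_{i=1}^{k-1}a_i(q_i-q_{i-1})+a_k(t-q_{k-1})\Big),\quad t\in[q_{k-1},q_k],\ k=1,\dots,m,$$ (empty sums are $0$), and $G_{A,Q}^{-1}(p)=\inf\{t\in[0,1]:G_{A,Q}(t)\ge p\}$, $G_{A,Q}^{-1+}(p)=\sup\{t\in[0,1]:G_{A,Q}(t)\le p\}$. *)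

theory Defs
  imports "HOL-Probability.Probability"
begin

abbreviation dist_fun :: "'a measure \<Rightarrow> ('a \<Rightarrow> real) \<Rightarrow> real \<Rightarrow> real" where
  "dist_fun M X \<equiv> cdf (distr M borel X)"

definition continuous_rv :: "'a measure \<Rightarrow> ('a \<Rightarrow> real) \<Rightarrow> bool" where
  "continuous_rv M X \<longleftrightarrow> X \<in> borel_measurable M \<and> continuous_on UNIV (dist_fun M X)"

text \<open>The quantiles may be infinite. The conventions for the infimum and supremum of the empty
  set and of the whole real line are those of the complete lattice of extended reals.\<close>

definition lower_quantile :: "(real \<Rightarrow> real) \<Rightarrow> real \<Rightarrow> ereal" where
  "lower_quantile F p = Inf (ereal ` {x. F x \<ge> p})"

definition upper_quantile :: "(real \<Rightarrow> real) \<Rightarrow> real \<Rightarrow> ereal" where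
  "upper_quantile F p = Sup (ereal ` {x. F x \<le> p})"

text \<open>The vectors $A$ and $Q$ are functions \<open>a\<close> and \<open>q\<close> on the natural numbers, of which only
  the values at \<open>1, \<dots>, m\<close> (and \<open>q 0 = 0\<close>) matter.

  The set \<open>weight_cell m q F k\<close> is where the weight is \<open>a k\<close>: its left end is
  the upper quantile at \<open>q 0\<close> for \<open>k = 1\<close> and a lower quantile otherwise, and its right end is
  included only for \<open>k = m\<close>. The case \<open>k = m = 1\<close> is covered.\<close>

definition weight_cell :: "nat \<Rightarrow> (nat \<Rightarrow> real) \<Rightarrow> (real \<Rightarrow> real) \<Rightarrow> nat \<Rightarrow> real set" where
  "weight_cell m q F k =
     {x. (if k = 1 then upper_quantile F (q 0) else lower_quantile F (q (k - 1))) \<le> ereal x \<and>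
         (if k = m then ereal x \<le> lower_quantile F (q k) else ereal x < lower_quantile F (q k))}"

text \<open>For a distribution function \<open>F\<close> the cells are pairwise disjoint, so at most one summand
  is nonzero.\<close>

definition step_weight ::
    "nat \<Rightarrow> (nat \<Rightarrow> real) \<Rightarrow> (nat \<Rightarrow> real) \<Rightarrow> (real \<Rightarrow> real) \<Rightarrow> real \<Rightarrow> real" where
  "step_weight m a q F x = (\<Sum>k=1..m. a k * indicator (weight_cell m q F k) x)"

text \<open>A step-weighted version of \<open>X\<close> may live on any probability space \<open>N\<close>; only its law is
  prescribed. The identity between distribution functions in differential form is an identity
  between the associated Lebesgue--Stieltjes measures, which are the laws.\<close>

definition step_weighted_version ::
    "nat \<Rightarrow> (nat \<Rightarrow> real) \<Rightarrow> (nat \<Rightarrow> real) \<Rightarrow>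
     'a measure \<Rightarrow> ('a \<Rightarrow> real) \<Rightarrow> 'b measure \<Rightarrow> ('b \<Rightarrow> real) \<Rightarrow> bool" where
  "step_weighted_version m a q M X N Y \<longleftrightarrow>
     prob_space N \<and> Y \<in> borel_measurable N \<and>
     distr N borel Y =
       density (distr M borel X)
         (\<lambda>x. ennreal (step_weight m a q (dist_fun M X) x
                        / (LINT w|M. step_weight m a q (dist_fun M X) (X w))))"

definition G_fun :: "nat \<Rightarrow> (nat \<Rightarrow> real) \<Rightarrow> (nat \<Rightarrow> real) \<Rightarrow> real \<Rightarrow> real" where
  "G_fun m a q t =
     (let k = (LEAST k. k \<in> {1..m} \<and> t \<in> {q (k - 1)..q k})
      in (\<Sum>i=1..k - 1. a i * (q i - q (i - 1))) + a k * (t - q (k - 1)))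
     / (\<Sum>i=1..m. a i * (q i - q (i - 1)))"

text \<open>The two inverses of \<open>G_fun\<close> range over the unit interval. For \<open>p\<close> in the unit interval
  the sets below are nonempty and bounded, so the real infimum and supremum suffice.\<close>

definition G_lower_inv :: "nat \<Rightarrow> (nat \<Rightarrow> real) \<Rightarrow> (nat \<Rightarrow> real) \<Rightarrow> real \<Rightarrow> real" where
  "G_lower_inv m a q p = Inf {t \<in> {0..1}. G_fun m a q t \<ge> p}"

definition G_upper_inv :: "nat \<Rightarrow> (nat \<Rightarrow> real) \<Rightarrow> (nat \<Rightarrow> real) \<Rightarrow> real \<Rightarrow> real" where
  "G_upper_inv m a q p = Sup {t \<in> {0..1}. G_fun m a q t \<le> p}"

end

theory Submission
  imports Defs
begin

text \<open>Write \<open>F\<close> for the distribution function of \<open>X\<close>. Since \<open>F\<close> is continuous,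
  \<open>F(X)\<close> is uniform on the unit interval and, up to a null set, the \<open>k\<close>-th weight cell is
  the event \<open>q (k - 1) \<le> F(X) < q k\<close>. As \<open>P(X \<le> x, F(X) < c) = min (F x) c\<close>, integrating
  the weight over \<open>{..x}\<close> gives the sum of \<open>a k * (min u (q k) - min u (q (k - 1)))\<close> at
  \<open>u = F x\<close>, and this is the unnormalised \<open>G\<close>. The quantile formulas follow because, for the
  monotone and continuous \<open>G\<close>, \<open>G u \<ge> p\<close> is equivalent to \<open>u \<ge> G\<^sup>-\<^sup>1 p\<close>, so both sides are
  infima of the same set; likewise for the upper quantiles.\<close>

section \<open>Quantiles and weight cells in terms of the distribution function\<close>

text \<open>Continuity supplies the strictness: if \<open>F x < p\<close>, then \<open>F\<close>
  stays below \<open>p\<close> up to some \<open>y > x\<close>, and by monotonicity this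
  \<open>y\<close> bounds the set \<open>{z. p \<le> F z}\<close> from below.\<close>

lemma less_lower_quantile_iff:
  assumes "mono F" "isCont F x"
  shows "ereal x < lower_quantile F p \<longleftrightarrow> F x < p"
proof
  assume "ereal x < lower_quantile F p"
  then show "F x < p"
    unfolding lower_quantile_def by (metis Inf_lower imageI leD mem_Collect_eq not_le)
next
  assume "F x < p"
  then have "\<forall>\<^sub>F y in at x. F y < p"
    using assms(2) by (auto simp: isCont_def intro: order_tendstoD)
  then have "\<forall>\<^sub>F y in at_right x. F y < p"
    by (simp add: eventually_at_split)
  then obtain b where b: "b > x" "\<And>y. x < y \<Longrightarrow> y < b \<Longrightarrow> F y < p"
    unfolding eventually_at_right_field by blast
  obtain y where y: "x < y" "y < b" using dense b(1) by blast
  have "ereal y \<le> lower_quantile F p"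
    unfolding lower_quantile_def
  proof (rule Inf_greatest, clarsimp)
    fix z assume "p \<le> F z"
    then show "y \<le> z" using b(2)[OF y] monoD[OF assms(1), of z y] by force
  qed
  then show "ereal x < lower_quantile F p"
    using y(1) by (metis ereal_less_eq(3) less_ereal.simps(1) order_less_le_trans)
qed

lemma upper_quantile_le:
  assumes "mono F" "p < F x"
  shows "upper_quantile F p \<le> ereal x"
  unfolding upper_quantile_def
proof (rule Sup_least, clarsimp)
  fix y assume "F y \<le> p"
  then show "y \<le> x" using assms(2) monoD[OF assms(1), of x y] by force
qed

text \<open>Restricting to \<open>0 < F x < 1\<close> makes the conventions at the two extreme ends
  harmless. For \<open>k = 1\<close> the left condition, with an upper quantile at 0, is true on
  both sides; for \<open>k = m\<close> so is the right condition, strict or not, because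
  \<open>q m = 1\<close>.\<close>

lemma weight_cell_iff:
  assumes "mono F" "isCont F x" "0 < F x" "F x < 1" "q 0 = 0" "q m = 1" "k \<in> {1..m}"
  shows "x \<in> weight_cell m q F k \<longleftrightarrow> q (k - 1) \<le> F x \<and> F x < q k"
proof -
  have *: "lower_quantile F p \<le> ereal x \<longleftrightarrow> p \<le> F x" for p
    using less_lower_quantile_iff[OF assms(1,2), of p] by (auto simp: not_less[symmetric])
  have "(if k = 1 then upper_quantile F (q 0) else lower_quantile F (q (k - 1))) \<le> ereal x
      \<longleftrightarrow> q (k - 1) \<le> F x"
    using upper_quantile_le[OF assms(1), of "q 0" x] assms(3,5) * by auto
  moreover have "(if k = m then ereal x \<le> lower_quantile F (q k) else ereal x < lower_quantile F (q k))
      \<longleftrightarrow> F x < q k"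
    using less_lower_quantile_iff[OF assms(1,2)] assms(4,6) by (auto intro: less_imp_le)
  ultimately show ?thesis
    unfolding weight_cell_def by simp
qed

section \<open>Uniformity of the transform by a continuous distribution function\<close>

lemma (in real_distribution) ex_cdf_eq:
  assumes "continuous_on UNIV (cdf M)" "0 < d" "d < 1"
  shows "\<exists>z. cdf M z = d"
proof -
  have "\<forall>\<^sub>F x in at_bot. cdf M x < d"
    using cdf_lim_at_bot assms(2) by (auto intro: order_tendstoD)
  then obtain l where l: "cdf M l < d" by (metis eventually_at_bot_linorder order_refl)
  have "\<forall>\<^sub>F x in at_top. cdf M x > d"
    using cdf_lim_at_top_prob assms(3) by (auto intro: order_tendstoD)
  then obtain u where u: "d < cdf M u" by (metis eventually_at_top_linorder order_refl)
  have "l \<le> u" using cdf_nondecreasing[of u l] l u by linarith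
  then show ?thesis
    using IVT'[of "cdf M" l d u] l u assms(1) by (auto intro: continuous_on_subset)
qed

text \<open>A point \<open>z\<close> with \<open>cdf M z = d\<close> turns the level
  \<open>d\<close> into the mass of \<open>{..z}\<close>. Such a half-line at level \<open>c\<close>
  covers the sublevel set; those at levels \<open>d < c\<close> lie inside it, and \<open>d\<close>
  tends to \<open>c\<close>.\<close>

lemma (in real_distribution) prob_cdf_less:
  assumes cont: "continuous_on UNIV (cdf M)" and c: "0 \<le> c" "c \<le> 1"
  shows "prob {y. cdf M y < c} = c"
proof (rule antisym)
  have [measurable]: "cdf M \<in> borel_measurable borel"
    using cont by (rule borel_measurable_continuous_onI)
  have ms: "{y. cdf M y < e} \<in> sets M" for e by simp
  \<comment> \<open>The levels 0 and 1 need not be attained; there the set is empty or the bound is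
    that of a probability.\<close>
  show "prob {y. cdf M y < c} \<le> c"
  proof (cases "c = 0 \<or> c = 1")
    case True
    then show ?thesis by (auto simp: not_less[THEN iffD2, OF cdf_nonneg])
  next
    case False
    then obtain z where z: "cdf M z = c" using ex_cdf_eq[OF cont, of c] c by force
    have "y \<le> z" if "cdf M y < c" for y
      using cdf_nondecreasing[of z y] z that by linarith
    then have "{y. cdf M y < c} \<subseteq> {..z}" by auto
    then show ?thesis
      using finite_measure_mono[of "{y. cdf M y < c}" "{..z}"] z by (simp add: cdf_def)
  qed
  show "c \<le> prob {y. cdf M y < c}"
  proof (rule dense_le)
    fix d assume d: "d < c"
    show "d \<le> prob {y. cdf M y < c}"
    proof (cases "d \<le> 0")
      case True
      then show ?thesis by (meson measure_nonneg order_trans)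
    next
      case False
      then obtain z where z: "cdf M z = d" using ex_cdf_eq[OF cont, of d] c d by force
      have "{..z} \<subseteq> {y. cdf M y < c}"
        using z d cdf_nondecreasing by (force intro: le_less_trans)
      then show ?thesis
        using finite_measure_mono[of "{..z}" "{y. cdf M y < c}"] z ms by (simp add: cdf_def)
    qed
  qed
qed

lemma (in real_distribution) AE_cdf_strictly_between:
  assumes cont: "continuous_on UNIV (cdf M)"
  shows "AE x in M. 0 < cdf M x \<and> cdf M x < 1"
proof -
  have [measurable]: "cdf M \<in> borel_measurable borel"
    using cont by (rule borel_measurable_continuous_onI)
  \<comment> \<open>The level \<open>min e 1\<close> is positive and stays in the unit interval,
    where uniformity applies.\<close>
  have "prob {x. cdf M x \<le> 0} \<le> e" if "0 < e" for e
  proof -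
    have "prob {x. cdf M x \<le> 0} \<le> prob {x. cdf M x < min e 1}"
      using that by (intro finite_measure_mono) auto
    also have "\<dots> \<le> e" using prob_cdf_less[OF cont, of "min e 1"] that by simp
    finally show ?thesis .
  qed
  then have "prob {x. cdf M x \<le> 0} = 0"
    by (meson field_le_epsilon measure_nonneg antisym dense_ge)
  then have "AE x in M. \<not> cdf M x \<le> 0"
    using prob_eq_0[of "{x. cdf M x \<le> 0}"] by simp
  moreover have "AE x in M. cdf M x < 1"
    using prob_cdf_less[OF cont, of 1] prob_eq_1[of "{x. cdf M x < 1}"] by simp
  ultimately show ?thesis by auto
qed

text \<open>Both \<open>{..x}\<close> and the sublevel set are closed downwards, hence nested, and
  the intersection is the smaller of the two.\<close>

lemma (in real_distribution) prob_atMost_cdf_less: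
  assumes cont: "continuous_on UNIV (cdf M)" and c: "0 \<le> c" "c \<le> 1"
  shows "prob {y. y \<le> x \<and> cdf M y < c} = min (cdf M x) c"
proof (cases "cdf M x < c")
  case True
  then have "{y. y \<le> x \<and> cdf M y < c} = {..x}"
    using cdf_nondecreasing by (force intro: le_less_trans)
  then show ?thesis using True by (simp add: cdf_def)
next
  case False
  then have "{y. y \<le> x \<and> cdf M y < c} = {y. cdf M y < c}"
    using cdf_nondecreasing[of x] by (auto simp: not_less) (meson le_cases not_less order_trans)
  then show ?thesis using False prob_cdf_less[OF cont c] by simp
qed

section \<open>The numerator of G without case distinction\<close>

text \<open>For increasing \<open>q\<close> and \<open>u \<ge> q 0\<close>, the k-th difference of
  minima is the length of the part of \<open>[q (k - 1), q k]\<close> below \<open>u\<close>. No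
  cell containing \<open>u\<close> has to be selected, and continuity and monotonicity can be
  checked term by term.\<close>

definition G_num :: "nat \<Rightarrow> (nat \<Rightarrow> real) \<Rightarrow> (nat \<Rightarrow> real) \<Rightarrow> real \<Rightarrow> real" where
  "G_num m a q u = (\<Sum>k=1..m. a k * (min u (q k) - min u (q (k - 1))))"

lemma continuous_G_num: "continuous_on S (G_num m a q)"
  unfolding G_num_def by (intro continuous_intros)

lemma mono_G_num:
  assumes "\<And>k. k \<in> {1..m} \<Longrightarrow> 0 \<le> a k" "\<And>k. k \<in> {1..m} \<Longrightarrow> q (k - 1) \<le> q k"
  shows "mono (G_num m a q)"
  unfolding G_num_def
proof (intro monoI sum_mono mult_left_mono)
  fix u v :: real and k assume "u \<le> v" "k \<in> {1..m}"
  then show "min u (q k) - min u (q (k - 1)) \<le> min v (q k) - min v (q (k - 1))"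
    using assms(2)[of k] by linarith
qed (rule assms(1))

lemma G_fun_eq:
  assumes m: "m \<ge> 1" and q: "mono_on {0..m} q" and u: "u \<in> {q 0..q m}"
  shows "G_fun m a q u = G_num m a q u / (\<Sum>i=1..m. a i * (q i - q (i - 1)))"
proof -
  let ?P = "\<lambda>k. k \<in> {1..m} \<and> u \<in> {q (k - 1)..q k}"
  define k where "k = (LEAST k. ?P k)"
  \<comment> \<open>\<open>j\<close> witnesses that the \<open>LEAST\<close> in \<open>G_fun\<close>
    is taken over a nonempty set: by minimality the previous right end lies below \<open>u\<close>,
    and for \<open>j = 1\<close> the lower bound is \<open>q 0 \<le> u\<close>.\<close>
  define j where "j = (LEAST j. j \<ge> 1 \<and> u \<le> q j)"
  have j: "j \<ge> 1 \<and> u \<le> q j" "j \<le> m"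
    unfolding j_def using m u by (auto intro: LeastI2[of _ m] Least_le)
  have "q (j - 1) \<le> u"
  proof (cases "j = 1")
    case False
    have "\<not> (j - 1 \<ge> 1 \<and> u \<le> q (j - 1))"
      by (rule not_less_Least, fold j_def) (use j in linarith)
    then show ?thesis using False j by linarith
  qed (use u in auto)
  with j have "?P j" by auto
  then have k: "k \<in> {1..m}" "q (k - 1) \<le> u" "u \<le> q k"
    using LeastI[of ?P j] unfolding k_def by auto
  have qm: "q i \<le> q l" if "i \<le> l" "l \<le> m" for i l
    using that by (auto intro: mono_onD[OF q])
  let ?t = "\<lambda>i. a i * (min u (q i) - min u (q (i - 1)))"
  \<comment> \<open>Cells before \<open>k\<close> lie at or below \<open>u\<close> and count with
    full length; cells after \<open>k\<close> lie at or above \<open>u\<close> and count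
    zero.\<close>
  have "{1..m} = {1..k - 1} \<union> ({k} \<union> {k<..m})" using k(1) by auto
  then have "G_num m a q u = (\<Sum>i=1..k - 1. ?t i) + (\<Sum>i\<in>{k} \<union> {k<..m}. ?t i)"
    unfolding G_num_def by (simp only:) (rule sum.union_disjoint, use k(1) in auto)
  also have "(\<Sum>i\<in>{k} \<union> {k<..m}. ?t i) = ?t k + (\<Sum>i\<in>{k<..m}. ?t i)"
    by simp
  also have "(\<Sum>i\<in>{k<..m}. ?t i) = 0"
  proof (rule sum.neutral, rule ballI)
    fix i assume "i \<in> {k<..m}"
    then have "q k \<le> q i" "q k \<le> q (i - 1)" by (auto intro!: qm)
    then show "?t i = 0" using k(3) by simp
  qed
  also have "(\<Sum>i=1..k - 1. ?t i) = (\<Sum>i=1..k - 1. a i * (q i - q (i - 1)))"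
  proof (rule sum.cong[OF refl])
    fix i assume "i \<in> {1..k - 1}"
    then have "q i \<le> q (k - 1)" "q (i - 1) \<le> q (k - 1)" using k(1) by (auto intro!: qm)
    then show "?t i = a i * (q i - q (i - 1))" using k(2) by (simp add: min_absorb2)
  qed
  finally show ?thesis
    using k(2,3) unfolding G_fun_def Let_def k_def[symmetric] by (simp add: min_absorb1 min_absorb2)
qed

lemma G_num_eq_total:
  assumes "mono_on {0..m} q"
  shows "G_num m a q (q m) = (\<Sum>i=1..m. a i * (q i - q (i - 1)))"
  unfolding G_num_def
proof (intro sum.cong refl)
  fix k assume "k \<in> {1..m}"
  then have "q k \<le> q m" "q (k - 1) \<le> q m" by (auto intro: mono_onD[OF assms])
  then show "a k * (min (q m) (q k) - min (q m) (q (k - 1))) = a k * (q k - q (k - 1))"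
    by (simp add: min_absorb2)
qed

section \<open>Integration of the step weight\<close>

lemma (in real_distribution)
  assumes cont: "continuous_on UNIV (cdf M)"
    and q: "mono_on {0..m} q" "q 0 = 0" "q m = 1"
  shows integrable_step_weight: "integrable M (\<lambda>y. step_weight m a q (cdf M) y * indicator {..x} y)" (is ?I)
    and integral_step_weight_atMost:
      "(LINT y|M. step_weight m a q (cdf M) y * indicator {..x} y) = G_num m a q (cdf M x)" (is ?E)
    and integral_step_weight:
      "(LINT y|M. step_weight m a q (cdf M) y) = G_num m a q 1" (is ?T)
    and borel_measurable_step_weight: "step_weight m a q (cdf M) \<in> borel_measurable borel" (is ?M)
proof -
  let ?F = "cdf M"
  have [measurable]: "?F \<in> borel_measurable borel"
    using cont by (rule borel_measurable_continuous_onI)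
  have mono: "mono ?F" using cdf_nondecreasing by (auto intro: monoI)
  have isc: "isCont ?F y" for y using cont by (simp add: continuous_on_eq_continuous_at)
  have [measurable]: "weight_cell m q ?F k \<in> sets borel" for k
    unfolding weight_cell_def by measurable
  show meas: ?M unfolding step_weight_def by measurable
  \<comment> \<open>Almost everywhere the indicator of the k-th cell is this difference of
    indicators of nested sublevel sets, whose masses are known.\<close>
  let ?d = "\<lambda>k y. indicator {y. ?F y < q k} y - indicator {y. ?F y < q (k - 1)} y :: real"
  have qb: "0 \<le> q k" "q k \<le> 1" if "k \<le> m" for k
    using mono_onD[OF q(1), of 0 k] mono_onD[OF q(1), of k m] q(2,3) that by auto
  have ae: "AE y in M. step_weight m a q ?F y = (\<Sum>k=1..m. a k * ?d k y)"
    using AE_cdf_strictly_between[OF cont]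
  proof eventually_elim
    case (elim y)
    show ?case unfolding step_weight_def
    proof (intro sum.cong refl arg_cong2[where f="(*)"])
      fix k assume k: "k \<in> {1..m}"
      then have "q (k - 1) \<le> q k" by (auto intro: mono_onD[OF q(1)])
      then show "indicator (weight_cell m q ?F k) y = ?d k y"
        using weight_cell_iff[OF mono isc _ _ q(2,3) k, of y] elim by (auto simp: indicator_def)
    qed
  qed
  have integ: "(LINT y|M. ?d k y * indicator A y)
      = prob {y. y \<in> A \<and> ?F y < q k} - prob {y. y \<in> A \<and> ?F y < q (k - 1)}"
    and integrable: "integrable M (\<lambda>y. ?d k y * indicator A y)"
    if [measurable]: "A \<in> sets borel" for A k
  proof -
    have *: "?d k y * indicator A y
        = indicator {y. y \<in> A \<and> ?F y < q k} y - indicator {y. y \<in> A \<and> ?F y < q (k - 1)} y" for y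
      by (auto simp: indicator_def)
    have "integrable M (indicator {y. y \<in> A \<and> ?F y < c} :: real \<Rightarrow> real)" for c
      by (intro integrable_real_indicator) (auto simp: less_top[symmetric])
    then show "(LINT y|M. ?d k y * indicator A y)
      = prob {y. y \<in> A \<and> ?F y < q k} - prob {y. y \<in> A \<and> ?F y < q (k - 1)}"
      "integrable M (\<lambda>y. ?d k y * indicator A y)"
      unfolding * by (simp_all add: Bochner_Integration.integral_diff)
  qed
  \<comment> \<open>The Borel set \<open>A\<close> is kept general: \<open>{..x}\<close> yields the
    unnormalised distribution function, \<open>UNIV\<close> the normalising constant.\<close>
  have all: "(LINT y|M. step_weight m a q ?F y * indicator A y)
      = (\<Sum>k=1..m. a k * (prob {y. y \<in> A \<and> ?F y < q k} - prob {y. y \<in> A \<and> ?F y < q (k - 1)}))"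
    (is "?l = ?r")
    and int: "integrable M (\<lambda>y. step_weight m a q ?F y * indicator A y)"
    if A[measurable]: "A \<in> sets borel" for A
  proof -
    note [measurable] = meas
    have ae': "AE y in M. step_weight m a q ?F y * indicator A y
        = (\<Sum>k=1..m. a k * (?d k y * indicator A y))"
      using ae by eventually_elim (simp add: sum_distrib_right mult.assoc)
    have "?l = (LINT y|M. (\<Sum>k=1..m. a k * (?d k y * indicator A y)))"
      by (rule integral_cong_AE[OF _ _ ae']) measurable
    also have "\<dots> = ?r"
      using integ[OF A] integrable[OF A] by (subst Bochner_Integration.integral_sum) auto
    finally show "?l = ?r" .
    have "integrable M (\<lambda>y. \<Sum>k=1..m. a k * (?d k y * indicator A y))"
      by (intro Bochner_Integration.integrable_sum integrable_mult_right integrable[OF A])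
    then show "integrable M (\<lambda>y. step_weight m a q ?F y * indicator A y)"
      by (subst integrable_cong_AE[OF _ _ ae']) measurable
  qed
  show ?I by (rule int) simp
  show ?E
    unfolding G_num_def
    by (subst all, simp, intro sum.cong refl)
      (auto simp: prob_atMost_cdf_less[OF cont] qb)
  have "(LINT y|M. step_weight m a q ?F y) = (LINT y|M. step_weight m a q ?F y * indicator UNIV y)"
    by simp
  also have "\<dots> = G_num m a q 1"
    unfolding G_num_def
    by (subst all, simp, intro sum.cong refl)
      (auto simp: prob_cdf_less[OF cont] qb min_absorb2)
  finally show ?T .
qed

section \<open>Generalised inverses on the unit interval\<close>

text \<open>Continuity makes the set closed, and \<open>p \<le> g 1\<close> puts 1 into it, so the
  infimum is attained; monotonicity then carries \<open>p \<le> g\<close> to every point on its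
  right.\<close>

lemma mono_continuous_Inf_le_iff:
  fixes g :: "real \<Rightarrow> real"
  assumes "mono_on {0..1} g" "continuous_on {0..1} g" "p \<le> g 1" "u \<in> {0..1}"
  shows "Inf {t \<in> {0..1}. g t \<ge> p} \<le> u \<longleftrightarrow> p \<le> g u"
proof -
  let ?S = "{t \<in> {0..1}. g t \<ge> p}"
  have bb: "bdd_below ?S" by (rule bdd_belowI[of _ 0]) auto
  have "closed ?S"
    using continuous_on_closed_Collect_le[of "{0..1}" "\<lambda>_. p" g] assms(2) by simp
  then have mem: "Inf ?S \<in> ?S"
    using assms(3) by (intro closed_contains_Inf bb) force+
  show ?thesis
  proof
    assume "Inf ?S \<le> u"
    then have "g (Inf ?S) \<le> g u" using mem assms(4) by (intro mono_onD[OF assms(1)]) auto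
    then show "p \<le> g u" using mem by auto
  next
    assume "p \<le> g u"
    then show "Inf ?S \<le> u" using assms(4) by (intro cInf_lower bb) auto
  qed
qed

text \<open>Mirror image: \<open>g 0 \<le> p\<close> makes the set nonempty and the supremum is
  attained.\<close>

lemma mono_continuous_le_Sup_iff:
  fixes g :: "real \<Rightarrow> real"
  assumes "mono_on {0..1} g" "continuous_on {0..1} g" "g 0 \<le> p" "u \<in> {0..1}"
  shows "u \<le> Sup {t \<in> {0..1}. g t \<le> p} \<longleftrightarrow> g u \<le> p"
proof -
  let ?S = "{t \<in> {0..1}. g t \<le> p}"
  have bb: "bdd_above ?S" by (rule bdd_aboveI[of _ 1]) auto
  have "closed ?S"
    using continuous_on_closed_Collect_le[of "{0..1}" g "\<lambda>_. p"] assms(2) by simp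
  then have mem: "Sup ?S \<in> ?S"
    using assms(3) by (intro closed_contains_Sup bb) force+
  show ?thesis
  proof
    assume "u \<le> Sup ?S"
    then have "g u \<le> g (Sup ?S)" using mem assms(4) by (intro mono_onD[OF assms(1)]) auto
    then show "g u \<le> p" using mem by auto
  next
    assume "g u \<le> p"
    then show "u \<le> Sup ?S" using assms(4) by (intro cSup_upper bb) auto
  qed
qed

section \<open>The distribution function and quantiles of the weighted version\<close>

theorem theorem3p8:
  fixes m :: nat and a q :: "nat \<Rightarrow> real"
    and M :: "'a measure" and X :: "'a \<Rightarrow> real"
    and N :: "'b measure" and Y :: "'b \<Rightarrow> real"
  assumes "m \<ge> 1"
    and "Min (a ` {1..m}) \<ge> 0"
    and "Max (a ` {1..m}) > 0"
    and "q 0 = 0"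
    and "\<And>k. k < m \<Longrightarrow> q k < q (Suc k)"
    and "q m = 1"
    and "prob_space M"
    and "continuous_rv M X"
    and "step_weighted_version m a q M X N Y"
  shows "(\<forall>x. dist_fun N Y x = G_fun m a q (dist_fun M X x)) \<and>
    (\<forall>p\<in>{0<..<1}. lower_quantile (dist_fun N Y) p
                    = lower_quantile (dist_fun M X) (G_lower_inv m a q p)) \<and>
    (\<forall>p\<in>{0<..<1}. upper_quantile (dist_fun N Y) p
                    = upper_quantile (dist_fun M X) (G_upper_inv m a q p))"
proof -
  define F where "F = dist_fun M X"
  let ?D = "distr M borel X"
  have X[measurable]: "X \<in> borel_measurable M" and cont: "continuous_on UNIV F"
    using assms(8) by (auto simp: continuous_rv_def F_def)
  interpret M: prob_space M by fact
  interpret D: real_distribution ?D by (rule M.real_distribution_distr) simp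
  have a0: "0 \<le> a k" if "k \<in> {1..m}" for k
    using assms(1,2) that by (subst (asm) Min_ge_iff) auto
  have "\<exists>k\<in>{1..m}. 0 < a k"
    using assms(1,3) by (subst (asm) Max_gr_iff) auto
  then obtain k0 where k0: "k0 \<in> {1..m}" "0 < a k0" by blast
  have qmono: "mono_on {0..m} q"
  proof (rule mono_onI)
    fix i j assume *: "i \<in> {0..m}" "j \<in> {0..m}" "i \<le> j"
    have "j \<le> m \<longrightarrow> q i \<le> q j"
      using \<open>i \<le> j\<close>
    proof (induction rule: dec_induct)
      case (step n)
      then show ?case using assms(5)[of n] by auto
    qed simp
    then show "q i \<le> q j" using * by simp
  qed
  have qs: "q (k - 1) < q k" if "k \<in> {1..m}" for k
    using assms(5)[of "k - 1"] that by auto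
  define T where "T = (\<Sum>i=1..m. a i * (q i - q (i - 1)))"
  have T: "T > 0"
    unfolding T_def using k0 a0 qs
    by (intro sum_pos2[of _ k0] mult_nonneg_nonneg) (auto intro!: less_imp_le)
  have T1: "G_num m a q 1 = T"
    using G_num_eq_total[OF qmono] assms(6) by (simp add: T_def)
  have N0: "G_num m a q 0 = 0"
    unfolding G_num_def using mono_onD[OF qmono, of 0] assms(4) by (intro sum.neutral) auto
  have monoN: "mono (G_num m a q)"
    using a0 qs by (intro mono_G_num) (auto intro: less_imp_le)
  have G: "G_fun m a q u = G_num m a q u / T" if "u \<in> {0..1}" for u
    using G_fun_eq[OF assms(1) qmono, of u a] that assms(4,6) by (simp add: T_def)
  have F01: "F x \<in> {0..1}" for x
    unfolding F_def using D.cdf_nonneg D.cdf_bounded_prob by auto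
  have wnn: "0 \<le> step_weight m a q F y" for y
    unfolding step_weight_def using a0 by (intro sum_nonneg mult_nonneg_nonneg) auto
  note [measurable] = D.borel_measurable_step_weight[OF cont[unfolded F_def] qmono assms(4,6), of a, folded F_def]
  \<comment> \<open>The expected weight equals the denominator of \<open>G_fun\<close>, so the
    density and \<open>G_fun\<close> share the same normalisation.\<close>
  have E: "(LINT w|M. step_weight m a q F (X w)) = T"
    using D.integral_step_weight[OF cont[unfolded F_def] qmono assms(4,6), of a] T1
    by (simp add: integral_distr F_def[symmetric])
  have Yd: "distr N borel Y = density ?D (\<lambda>x. ennreal (step_weight m a q F x / T))"
    using assms(9) E unfolding step_weighted_version_def F_def[symmetric] by simp
  have cdfY: "dist_fun N Y x = G_fun m a q (F x)" for x
  proof -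
    have "emeasure (distr N borel Y) {..x}
        = (\<integral>\<^sup>+y. ennreal (step_weight m a q F y / T) * indicator {..x} y \<partial>?D)"
      unfolding Yd by (subst emeasure_density) auto
    also have "\<dots> = (\<integral>\<^sup>+y. ennreal (step_weight m a q F y * indicator {..x} y / T) \<partial>?D)"
      by (intro nn_integral_cong) (auto simp: indicator_def)
    also have "\<dots> = ennreal (LINT y|?D. step_weight m a q F y * indicator {..x} y / T)"
      using wnn T D.integrable_step_weight[OF cont[unfolded F_def] qmono assms(4,6), of a x]
      by (intro nn_integral_eq_integral) (auto simp: F_def[symmetric])
    also have "(LINT y|?D. step_weight m a q F y * indicator {..x} y / T) = G_num m a q (F x) / T"
      using D.integral_step_weight_atMost[OF cont[unfolded F_def] qmono assms(4,6), of a x]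
      by (simp add: F_def[symmetric])
    finally have *: "emeasure (distr N borel Y) {..x} = ennreal (G_num m a q (F x) / T)" .
    \<comment> \<open>Passing from \<open>emeasure\<close> to the real-valued measure preserves the
      value because it is nonnegative.\<close>
    have "0 \<le> G_num m a q (F x)" using N0 monoD[OF monoN, of 0 "F x"] F01[of x] by simp
    then show ?thesis
      using * T G[OF F01] unfolding cdf_def measure_def by simp
  qed
  have Gm: "mono_on {0..1} (G_fun m a q)"
    using G T monoD[OF monoN] by (intro mono_onI) (auto intro!: divide_right_mono)
  have Gc: "continuous_on {0..1} (G_fun m a q)"
    using T by (subst continuous_on_cong[OF refl G])
      (auto intro!: continuous_intros continuous_G_num)
  have G1: "G_fun m a q 1 = 1" using G[of 1] T T1 by simp
  have G0: "G_fun m a q 0 = 0" using G[of 0] N0 by simp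
  \<comment> \<open>At \<open>u = F x\<close> the equivalence makes both infima range over the same
    set of \<open>x\<close>; its side condition is \<open>p \<le> 1 = G_fun m a q 1\<close>.\<close>
  have low: "lower_quantile (dist_fun N Y) p = lower_quantile F (G_lower_inv m a q p)"
    if "p \<in> {0<..<1}" for p
    using mono_continuous_Inf_le_iff[OF Gm Gc _ F01, of p] that G1
    unfolding lower_quantile_def cdfY G_lower_inv_def by simp
  \<comment> \<open>Here the side condition is \<open>G_fun m a q 0 = 0 \<le> p\<close>.\<close>
  have upp: "upper_quantile (dist_fun N Y) p = upper_quantile F (G_upper_inv m a q p)"
    if "p \<in> {0<..<1}" for p
    using mono_continuous_le_Sup_iff[OF Gm Gc _ F01, of p] that G0
    unfolding upper_quantile_def cdfY G_upper_inv_def by simp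
  show ?thesis
    using cdfY low upp unfolding F_def by blast
qed

end
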